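(* Let $X$ be a countably infinite set and let $A\leq\operatorname{Sym}(X)$ have infinite motion. Then there is a subgroup $B\leq A$ with $\operatorname{D}(B,X)=2$ and $\operatorname{cl}_A(B)=A$.
   Context: The motion of $A$ is the minimum, over nonidentity $a\in A$, of $|\{x\in X:ax\neq x\}|$; infinite motion means this minimum is infinite. $\operatorname{D}(B,X)$ is the least cardinal $d$ such that some coloring of $X$ with $d$ colors is preserved only by the identity of $B$. $\operatorname{cl}_A(B)$ is the set of $a\in A$ such that for every finite $Y\subseteq X$ some $b\in B$ satisfies $ay=by$ for all $y\in Y$. (Axiom of Choice assumed.) *)

theory Defs
  imports "HOL-Algebra.Bij" "HOL-Library.Countable_Set"
begin

unbundle cardinal_syntax

text \<open>
  The symmetric group of \<open>X\<close> is \<open>BijGroup X\<close>, whose elements are the bijections of \<open>X\<close>,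
  extended by \<open>undefined\<close> outside \<open>X\<close>. Cardinals are cardinal orders, compared by
  \<open>\<le>o\<close> and identified up to \<open>=o\<close>.
\<close>

definition moved :: "'a set \<Rightarrow> ('a \<Rightarrow> 'a) \<Rightarrow> 'a set" where
  "moved X a = {x \<in> X. a x \<noteq> x}"

text \<open>
  \<open>is_motion X A k\<close> says that the minimum defining the motion of \<open>A\<close> is attained and equals \<open>k\<close>.
  It is false for every \<open>k\<close> when \<open>A\<close> is trivial, as then there is nothing to minimize over.
\<close>

definition is_motion :: "'a set \<Rightarrow> ('a \<Rightarrow> 'a) set \<Rightarrow> 'a rel \<Rightarrow> bool" where
  "is_motion X A k \<longleftrightarrow> Card_order k \<and>
     (\<exists>a \<in> A - {\<one>\<^bsub>BijGroup X\<^esub>}. k =o |moved X a| ) \<and>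
     (\<forall>a \<in> A - {\<one>\<^bsub>BijGroup X\<^esub>}. k \<le>o |moved X a| )"

definition infinite_motion :: "'a set \<Rightarrow> ('a \<Rightarrow> 'a) set \<Rightarrow> bool" where
  "infinite_motion X A \<longleftrightarrow> (\<exists>k. is_motion X A k \<and> cinfinite k)"

definition preserves_coloring :: "'a set \<Rightarrow> ('a \<Rightarrow> 'c) \<Rightarrow> ('a \<Rightarrow> 'a) \<Rightarrow> bool" where
  "preserves_coloring X c b \<longleftrightarrow> (\<forall>x \<in> X. c (b x) = c x)"

text \<open>The field of the cardinal \<open>d\<close> serves as the set of \<open>d\<close> colors.\<close>

definition has_distinguishing_coloring ::
    "'a set \<Rightarrow> ('a \<Rightarrow> 'a) set \<Rightarrow> 'c rel \<Rightarrow> bool" where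
  "has_distinguishing_coloring X B d \<longleftrightarrow>
     (\<exists>c \<in> X \<rightarrow> Field d. \<forall>b \<in> B. preserves_coloring X c b \<longrightarrow> b = \<one>\<^bsub>BijGroup X\<^esub>)"

text \<open>
  \<open>is_distinguishing_number X B d\<close> says \<open>D(B,X) = d\<close>. The competing cardinals \<open>e\<close> live on the type
  of \<open>X\<close>. This loses nothing: an injective coloring uses \<open>|X|\<close> colors and is preserved only
  by the identity, so the least cardinal is at most \<open>|X|\<close>.
\<close>

definition is_distinguishing_number ::
    "'a set \<Rightarrow> ('a \<Rightarrow> 'a) set \<Rightarrow> 'c rel \<Rightarrow> bool" where
  "is_distinguishing_number X B d \<longleftrightarrow>
     Card_order d \<and> has_distinguishing_coloring X B d \<and>
     (\<forall>e :: 'a rel. Card_order e \<and> has_distinguishing_coloring X B e \<longrightarrow> d \<le>o e)"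

definition closure_in :: "'a set \<Rightarrow> ('a \<Rightarrow> 'a) set \<Rightarrow> ('a \<Rightarrow> 'a) set \<Rightarrow> ('a \<Rightarrow> 'a) set" where
  "closure_in X A B = {a \<in> A. \<forall>Y. finite Y \<and> Y \<subseteq> X \<longrightarrow> (\<exists>b \<in> B. \<forall>y \<in> Y. a y = b y)}"

end

theory Submission
  imports Defs "HOL-Algebra.Generated_Groups"
begin

text \<open>
  The topology of pointwise convergence on \<open>A\<close> is second countable, so \<open>A\<close> has a countable dense
  subgroup \<open>B\<close>. Enumerate the nonidentity elements of \<open>B\<close> as \<open>b 0, b 1, \<dots>\<close>. As each \<open>b n\<close> moves
  infinitely many points, one can pick points \<open>x n\<close> moved by \<open>b n\<close> such that the pairs
  \<open>{x n, b n (x n)}\<close> are pairwise disjoint. Coloring the points \<open>x n\<close> in one color and all others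
  in a second color breaks every \<open>b n\<close>.
\<close>

text \<open>Every element of the generated subgroup is the product of a finite word in the elements
  of \<open>S\<close> and their inverses, and a countable alphabet has only countably many finite
  words.\<close>

lemma (in group) countable_generate:
  assumes "S \<subseteq> carrier G" and "countable S"
  shows "countable (generate G S)"
proof -
  let ?T = "S \<union> m_inv G ` S"
  let ?word = "\<lambda>ws. foldr (\<otimes>) ws \<one>"
  have T: "?T \<subseteq> carrier G" using assms(1) by auto
  have closed: "?word ws \<in> carrier G" if "ws \<in> lists ?T" for ws
    using that T by (induction ws) auto
  have append: "?word (us @ vs) = ?word us \<otimes> ?word vs"
    if "us \<in> lists ?T" "vs \<in> lists ?T" for us vs
    using that
  proof (induction us)
    case Nil
    then show ?case using closed by simp
  next
    case (Cons u us)
    then have "u \<in> carrier G" using T by auto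
    with Cons show ?case using closed by (auto simp: m_assoc)
  qed
  have "g \<in> ?word ` lists ?T" if "g \<in> generate G S" for g
    using that
  proof (induction rule: generate.induct)
    case one
    show ?case by (rule image_eqI[of _ _ "[]"]) auto
  next
    case (incl h)
    then show ?case using T by (intro image_eqI[of _ _ "[h]"]) auto
  next
    case (inv h)
    then show ?case using T by (intro image_eqI[of _ _ "[inv h]"]) auto
  next
    case (eng h1 h2)
    then obtain us vs where "us \<in> lists ?T" "h1 = ?word us" "vs \<in> lists ?T" "h2 = ?word vs"
      by blast
    then show ?case using append by (intro image_eqI[of _ _ "us @ vs"]) auto
  qed
  moreover have "countable (?word ` lists ?T)"
    using assms(2) by (intro countable_image countable_lists) auto
  ultimately show ?thesis by (meson countable_subset subsetI)
qed

text \<open>There are only countably many pairs of finite lists over \<open>X\<close>. For each pair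
  \<open>(xs, ys)\<close> such that some element of \<open>A\<close> maps \<open>xs\<close> to
  \<open>ys\<close>, one such element is picked; listing a finite \<open>Y\<close> as
  \<open>xs\<close> then yields a pick that agrees with a given \<open>a\<close> on
  \<open>Y\<close>.\<close>

lemma countable_pointwise_dense_subset:
  assumes "countable X" and "\<And>a. a \<in> A \<Longrightarrow> a ` X \<subseteq> X"
  obtains S where "S \<subseteq> A" "countable S" "closure_in X A S = A"
proof
  let ?I = "{(xs, ys). xs \<in> lists X \<and> ys \<in> lists X \<and> (\<exists>a\<in>A. map a xs = ys)}"
  define pick where "pick = (\<lambda>(xs, ys). SOME a. a \<in> A \<and> map a xs = ys)"
  have pick: "pick (xs, ys) \<in> A \<and> map (pick (xs, ys)) xs = ys" if "(xs, ys) \<in> ?I" for xs ys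
    using that someI_ex[of "\<lambda>a. a \<in> A \<and> map a xs = ys"] by (auto simp: pick_def)
  show "pick ` ?I \<subseteq> A" using pick by blast
  have "countable (lists X \<times> lists X)" using assms(1) by (intro countable_SIGMA countable_lists)
  then have "countable ?I" by (rule countable_subset[rotated]) auto
  then show "countable (pick ` ?I)" by (rule countable_image)
  show "closure_in X A (pick ` ?I) = A"
  proof (intro equalityI subsetI)
    fix a assume a: "a \<in> A"
    have "\<exists>b\<in>pick ` ?I. \<forall>y\<in>Y. a y = b y" if "finite Y" "Y \<subseteq> X" for Y
    proof -
      obtain xs where xs: "set xs = Y" using \<open>finite Y\<close> finite_list by blast
      have I: "(xs, map a xs) \<in> ?I" using a xs \<open>Y \<subseteq> X\<close> assms(2)[OF a] by fastforce
      then have "\<forall>y\<in>Y. a y = pick (xs, map a xs) y" using pick[OF I] xs by auto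
      with imageI[OF I, of pick] show ?thesis by (intro bexI[of _ "pick (xs, map a xs)"])
    qed
    with a show "a \<in> closure_in X A (pick ` ?I)" by (auto simp: closure_in_def)
  qed (auto simp: closure_in_def)
qed

lemma exists_disjoint_moved_pairs:
  fixes b :: "nat \<Rightarrow> 'a \<Rightarrow> 'a"
  assumes inj: "\<And>n. inj_on (b n) X" and inf: "\<And>n. infinite (moved X (b n))"
  obtains x where "\<And>n. x n \<in> moved X (b n)"
    and "\<And>m n. m < n \<Longrightarrow> {x n, b n (x n)} \<inter> {x m, b m (x m)} = {}"
proof -
  let ?P = "\<lambda>f n r. r \<in> moved X (b n) \<and> (\<forall>m<n. {r, b n r} \<inter> {f m, b m (f m)} = {})"
  have "\<exists>x. \<forall>n. ?P x n (x n)"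
  \<comment> \<open>Recursion along \<open><\<close>: the condition on the \<open>n\<close>-th point
    involves \<open>f\<close> only below \<open>n\<close>, which the closing \<open>simp\<close>
    checks.\<close>
  proof (rule dependent_wf_choice[OF wf_less_than])
    fix n and f :: "nat \<Rightarrow> 'a"
    define F where "F = (\<Union>m<n. {f m, b m (f m)})"
    have "finite F" by (simp add: F_def)
    moreover have "inj_on (b n) (moved X (b n))"
      using inj[of n] by (rule inj_on_subset) (auto simp: moved_def)
    \<comment> \<open>The bad candidates are the points of earlier pairs and the points that
      \<open>b n\<close> sends into such pairs; injectivity keeps the latter finite in
      number.\<close>
    ultimately have "finite (F \<union> (b n -` F \<inter> moved X (b n)))"
      by (simp add: finite_vimage_IntI)
    then have "\<not> moved X (b n) \<subseteq> F \<union> (b n -` F \<inter> moved X (b n))"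
      using inf finite_subset by blast
    then obtain r where "r \<in> moved X (b n)" "r \<notin> F" "b n r \<notin> F" by auto
    then have "?P f n r" unfolding F_def by blast
    then show "\<exists>r. ?P f n r" ..
  qed simp
  then show ?thesis using that by blast
qed

lemma two_coloring_breaks_countable_family:
  assumes "countable C" and "\<And>b. b \<in> C \<Longrightarrow> inj_on b X" and "\<And>b. b \<in> C \<Longrightarrow> infinite (moved X b)"
  obtains c :: "'a \<Rightarrow> bool" where "\<And>b. b \<in> C \<Longrightarrow> \<not> preserves_coloring X c b"
proof (cases "C = {}")
  case True
  then show ?thesis using that by blast
next
  case False
  \<comment> \<open>If \<open>C\<close> is finite, this enumeration repeats elements; the pairs can
    still be chosen disjoint, as each moved set is infinite.\<close>
  define b where "b = from_nat_into C"
  have range: "range b = C" using False assms(1) by (simp add: b_def)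
  then have "\<And>n. b n \<in> C" by blast
  then obtain x where moved: "\<And>n. x n \<in> moved X (b n)"
    and disj: "\<And>m n. m < n \<Longrightarrow> {x n, b n (x n)} \<inter> {x m, b m (x m)} = {}"
    using exists_disjoint_moved_pairs[of b X] assms(2,3) by metis
  have "b n (x n) \<notin> range x" for n
  proof
    assume "b n (x n) \<in> range x"
    then obtain m where m: "b n (x n) = x m" by blast
    then have "m \<noteq> n" using moved[of n] by (auto simp: moved_def)
    \<comment> \<open>The point \<open>x m\<close> would lie in both the \<open>m\<close>-th and the
      \<open>n\<close>-th pair.\<close>
    then show False using m disj[of m n] disj[of n m] by (cases "m < n") auto
  qed
  then have "\<not> preserves_coloring X (\<lambda>y. y \<in> range x) (b n)" for n
    using moved[of n] by (auto simp: preserves_coloring_def moved_def)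
  then show ?thesis using that range by (metis imageE)
qed

lemma infinite_moved:
  fixes X :: "'a set"
  assumes "infinite_motion X A" and "a \<in> A" and "a \<noteq> \<one>\<^bsub>BijGroup X\<^esub>"
  shows "infinite (moved X a)"
proof -
  obtain k :: "'a rel" where k: "Card_order k" "cinfinite k" "k \<le>o |moved X a|"
    using assms unfolding infinite_motion_def is_motion_def by blast
  then have "|Field k| \<le>o |moved X a|"
    using card_of_Field_ordIso ordIso_ordLeq_trans by blast
  then show ?thesis
    using k(2) card_of_ordLeq_finite by (auto simp: cinfinite_def)
qed

text \<open>The coloring must break \<open>b\<close>, so some \<open>x\<close> and
  \<open>b x\<close> receive different colors. These two colors give an injection of
  \<open>bool\<close> into \<open>Field e\<close>.\<close>

lemma ctwo_ordLeq_if_has_distinguishing_coloring: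
  fixes e :: "'c rel"
  assumes "b \<in> B" "b \<noteq> \<one>\<^bsub>BijGroup X\<^esub>" "b ` X \<subseteq> X"
    and e: "Card_order e" "has_distinguishing_coloring X B e"
  shows "ctwo \<le>o e"
proof -
  obtain c where c: "c \<in> X \<rightarrow> Field e" "\<not> preserves_coloring X c b"
    using e(2) assms(1,2) by (auto simp: has_distinguishing_coloring_def)
  then obtain x where x: "x \<in> X" "c (b x) \<noteq> c x" by (auto simp: preserves_coloring_def)
  then have "c (b x) \<in> Field e" "c x \<in> Field e" using c(1) assms(3) by auto
  then have "(\<lambda>t. if t then c x else c (b x)) ` UNIV \<subseteq> Field e" by auto
  moreover have "inj (\<lambda>t. if t then c x else c (b x))" using x by (auto simp: inj_def)
  ultimately have "|UNIV :: bool set| \<le>o |Field e|" using card_of_ordLeq by blast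
  then show ?thesis
    unfolding ctwo_def using card_of_Field_ordIso[OF e(1)] ordLeq_ordIso_trans by blast
qed

theorem theorem4p4:
  fixes X :: "'a set" and A :: "('a \<Rightarrow> 'a) set"
  assumes "countable X" and "infinite X"
    and "subgroup A (BijGroup X)"
    and "infinite_motion X A"
  shows "\<exists>B. subgroup B (BijGroup X) \<and> B \<subseteq> A \<and>
           is_distinguishing_number X B ctwo \<and> closure_in X A B = A"
proof -
  interpret group "BijGroup X" by (rule group_BijGroup)
  have Bij: "A \<subseteq> Bij X" using subgroup.subset[OF assms(3)] by (simp add: BijGroup_def)
  then have maps: "a ` X \<subseteq> X" and inj: "inj_on a X" if "a \<in> A" for a
    using that by (auto simp: Bij_def bij_betw_def)
  obtain S where S: "S \<subseteq> A" "countable S" "closure_in X A S = A"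
    using countable_pointwise_dense_subset[OF assms(1) maps] by blast
  define B where "B = generate (BijGroup X) S"
  have S_carrier: "S \<subseteq> carrier (BijGroup X)" using S(1) subgroup.subset[OF assms(3)] by blast
  have B: "subgroup B (BijGroup X)"
    unfolding B_def by (rule generate_is_subgroup[OF S_carrier])
  have BA: "B \<subseteq> A"
    unfolding B_def by (rule generate_subgroup_incl[OF S(1) assms(3)])
  have "countable B"
    unfolding B_def by (rule countable_generate[OF S_carrier S(2)])
  have "S \<subseteq> B" unfolding B_def by (auto intro: generate.incl)
  \<comment> \<open>\<open>closure_in\<close> is monotone in its last argument and never leaves
    \<open>A\<close>.\<close>
  then have dense: "closure_in X A B = A"
    using S(3) by (fastforce simp: closure_in_def)
  have "countable (B - {\<one>\<^bsub>BijGroup X\<^esub>})" using \<open>countable B\<close> by simp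
  moreover have "inj_on b X" "infinite (moved X b)" if "b \<in> B - {\<one>\<^bsub>BijGroup X\<^esub>}" for b
    using that BA inj infinite_moved[OF assms(4), of b] by auto
  ultimately obtain c :: "'a \<Rightarrow> bool"
    where c: "\<And>b. b \<in> B - {\<one>\<^bsub>BijGroup X\<^esub>} \<Longrightarrow> \<not> preserves_coloring X c b"
    using two_coloring_breaks_countable_family by metis
  have coloring: "has_distinguishing_coloring X B ctwo"
    unfolding has_distinguishing_coloring_def using c
    by (intro bexI[of _ c]) (auto simp: ctwo_def Field_card_of)
  \<comment> \<open>One color suffices only for a trivial group, so minimality of two requires a
    nonidentity element of \<open>B\<close>. Since the motion is attained, \<open>A\<close> has a
    nonidentity element \<open>a\<close>; density at a single point moved by \<open>a\<close>
    transfers this to \<open>B\<close>.\<close>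
  obtain a where a: "a \<in> A" "a \<noteq> \<one>\<^bsub>BijGroup X\<^esub>"
    using assms(4) by (auto simp: infinite_motion_def is_motion_def)
  then obtain x where x: "x \<in> X" "a x \<noteq> x"
    using infinite_moved[OF assms(4)] by (force simp: moved_def dest: infinite_imp_nonempty)
  have "\<exists>b\<in>B. \<forall>y\<in>{x}. a y = b y"
    using a(1) x(1) dense unfolding closure_in_def by blast
  then obtain b where b: "b \<in> B" "a x = b x" by auto
  then have "b \<noteq> \<one>\<^bsub>BijGroup X\<^esub>" using x by (auto simp: BijGroup_def)
  then have "is_distinguishing_number X B ctwo"
    unfolding is_distinguishing_number_def
    using coloring Card_order_ctwo b(1) BA maps ctwo_ordLeq_if_has_distinguishing_coloring
    by (metis subsetD)
  with B BA dense show ?thesis by blast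
qed

end
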